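(* For all positive integers $k$ and $c$, the van der Waerden number $w(k;c)$ for $c$-colored $k$-term arithmetic progressions satisfies \[ w(k;c) \;\geq\; \frac{c^{k-3}}{k}\cdot\frac{k-1}{k} \;=\; \frac{c^{k-3}}{k}\,(1-o(1)), \] where $o(1)$ denotes a quantity tending to $0$ as $k\to\infty$ (and $c^{k-3}$ is the real power, so it may be less than $1$ when $k<3$).
   Context: A $k$-term arithmetic progression with gap $d$ is a set of the form $\{a, a+d, \ldots, a+(k-1)d\}$ with $a,d$ positive integers. A string of length $n$ over an alphabet $\Sigma$ with $|\Sigma|=c$ is identified with a coloring $\chi\colon\{1,\ldots,n\}\to\Sigma$ with $c$ colors; a progression contained in $\{1,\ldots,n\}$ is monochromatic if $\chi$ restricted to it is constant. The van der Waerden number $w(k;c)$ is the smallest positive integer $n$ such that every string of length $n$ over an alphabet of size $c$ (equivalently, every coloring of $\{1,\ldots,n\}$ with $c$ colors) contains a monochromatic $k$-term arithmetic progression. It exists by van der Waerden's theorem. *)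

theory Defs
  imports "HOL-Analysis.Analysis"
begin

definition arith_progs :: "nat \<Rightarrow> nat set set" where
  "arith_progs k = {(\<lambda>i. a + i * d) ` {..<k} | a d. 0 < a \<and> 0 < d}"

text \<open>Every string of length \<open>n\<close> over the alphabet \<open>{..<c}\<close>, read as a coloring of \<open>{1..n}\<close>,
  contains a monochromatic \<open>k\<close>-term arithmetic progression. A coloring is a total function
  of which only the values on \<open>{1..n}\<close> matter.\<close>

definition vdW_prop :: "nat \<Rightarrow> nat \<Rightarrow> nat \<Rightarrow> bool" where
  "vdW_prop k c n \<longleftrightarrow>
     (\<forall>f \<in> {1..n} \<rightarrow> {..<c}. \<exists>P \<in> arith_progs k. P \<subseteq> {1..n} \<and> f constant_on P)"

text \<open>The minimum is attained by van der Waerden's theorem; without that theorem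
  the \<open>LEAST\<close> below would be unspecified.\<close>

definition vdW :: "nat \<Rightarrow> nat \<Rightarrow> nat" where
  "vdW k c = (LEAST n. 0 < n \<and> vdW_prop k c n)"

end

(* The LEAST in the definition of vdW is attained by van der Waerden's theorem, proved here by
   colour focusing: k-term progressions of identically coloured blocks turn r progressions of
   different colours with a common next term into r + 1 such progressions.

   The lower bound follows from Rosenfeld's counting argument. Let N(S) be the number of colourings
   of S without a monochromatic progression. If every point lies in at most D progressions, then
   N(S + v) >= c N(S) - D b^-(k-2) N(S), by induction, as long as N grows at least by the factor b
   with each point: a colouring that becomes bad through a progression P containing v is determined
   by its values outside of all but one of the points of P - v. With b = c (1 - 1/(2k)) the right
   side is at least b N(S) when D <= c^(k-3) / k, and D <= k (n-1) / (k-1) on {1..n}. *)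
theory Submission
  imports Defs
begin

section \<open>Van der Waerden's theorem\<close>

text \<open>The extra term \<open>a + k * d\<close> carries no condition on its colour, but must lie in the range: in
  the block argument it is the block containing the new focus.\<close>

definition has_mono_prog :: "nat \<Rightarrow> nat \<Rightarrow> (nat \<Rightarrow> 'a) \<Rightarrow> bool" where
  "has_mono_prog k N f \<longleftrightarrow> (\<exists>a d. 0 < d \<and> a + k * d < N \<and> (\<forall>i<k. f (a + i * d) = f a))"

text \<open>The colour of the focus \<open>x\<close> itself is left free, so that progressions of
  different colours can share it.\<close>

definition focused :: "nat \<Rightarrow> (nat \<Rightarrow> 'a) \<Rightarrow> nat \<Rightarrow> 'a \<Rightarrow> bool" where
  "focused k f x q \<longleftrightarrow> (\<exists>a d. 0 < d \<and> a + k * d = x \<and> (\<forall>i<k. f (a + i * d) = q))"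

definition mono_prog_upto :: "nat \<Rightarrow> nat \<Rightarrow> (nat \<Rightarrow> 'a) \<Rightarrow> bool" where
  "mono_prog_upto k N f \<longleftrightarrow> (\<exists>a d. 0 < d \<and> a + k * d < N \<and> (\<forall>i\<le>k. f (a + i * d) = f a))"

text \<open>Blocks will serve as colours, so an arbitrary finite colour set is needed; a bijection
  with \<open>{..<card C}\<close> transfers the bound.\<close>

lemma has_mono_prog_finite_colors:
  fixes C :: "'a set"
  assumes "\<And>c. \<exists>N. \<forall>f \<in> {..<N} \<rightarrow> {..<c::nat}. has_mono_prog k N f"
    and "finite C"
  shows "\<exists>N. \<forall>f \<in> {..<N} \<rightarrow> C. has_mono_prog k N f"
proof -
  obtain h where h: "bij_betw h C {..<card C}"
    using ex_bij_betw_finite_nat[OF \<open>finite C\<close>] by (auto simp: atLeast0LessThan)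
  obtain N where N: "\<And>f. f \<in> {..<N} \<rightarrow> {..<card C} \<Longrightarrow> has_mono_prog k N f"
    using assms(1) by metis
  have "has_mono_prog k N f" if f: "f \<in> {..<N} \<rightarrow> C" for f
  proof -
    have "h \<circ> f \<in> {..<N} \<rightarrow> {..<card C}"
      using f bij_betw_imp_surj_on[OF h] by (fastforce simp: Pi_iff)
    from N[OF this] obtain a d where ad: "0 < d" "a + k * d < N"
      "\<And>i. i < k \<Longrightarrow> h (f (a + i * d)) = h (f a)"
      by (auto simp: has_mono_prog_def)
    have "f (a + i * d) = f a" if "i < k" for i
    proof -
      have "i * d \<le> k * d" using that by simp
      then have "a + i * d < N" "a < N" using ad(2) by linarith+
      then have "f (a + i * d) \<in> C" "f a \<in> C" using f by auto
      then show ?thesis using ad(3)[OF that] h by (auto simp: bij_betw_def inj_on_def)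
    qed
    then show ?thesis using ad by (auto simp: has_mono_prog_def)
  qed
  then show ?thesis by blast
qed

lemma mono_prog_upto_shift:
  assumes "mono_prog_upto k N (\<lambda>y. f (s + y))" and "s + N \<le> L"
  shows "mono_prog_upto k L f"
proof -
  obtain a d where "0 < d" "a + k * d < N" "\<forall>i\<le>k. f (s + (a + i * d)) = f (s + a)"
    using assms(1) by (auto simp: mono_prog_upto_def)
  then have "0 < d \<and> (s + a) + k * d < L \<and> (\<forall>i\<le>k. f ((s + a) + i * d) = f (s + a))"
    using assms(2) by (auto simp: add.assoc)
  then show ?thesis unfolding mono_prog_upto_def by blast
qed

text \<open>A focus that carries the colour of one of its progressions is its missing term of index
  \<open>k\<close>.\<close>

lemma mono_prog_upto_focused:
  assumes "focused k f x (f x)" and "x < N" and "0 < k"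
  shows "mono_prog_upto k N f"
proof -
  obtain a d where ad: "0 < d" "a + k * d = x" "\<forall>i<k. f (a + i * d) = f x"
    using assms(1) by (auto simp: focused_def)
  have "f (a + i * d) = f a" if "i \<le> k" for i
    using that ad(2) ad(3)[rule_format, of 0] ad(3) \<open>0 < k\<close>
    by (cases "i = k") auto
  then show ?thesis using ad assms(2) unfolding mono_prog_upto_def by blast
qed

text \<open>Induction on \<open>r\<close>: \<open>{..<M * N}\<close> is cut into \<open>M\<close>
  blocks of length \<open>N\<close>, with \<open>N\<close> good for \<open>r\<close> and
  \<open>M\<close> good for the colouring of blocks by their patterns.\<close>

lemma color_focusing:
  assumes IH: "\<And>c. \<exists>N. \<forall>f \<in> {..<N} \<rightarrow> {..<c::nat}. has_mono_prog k N f"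
    and "0 < k"
  shows "\<exists>N. \<forall>f \<in> {..<N} \<rightarrow> {..<c::nat}. mono_prog_upto k N f \<or>
           (\<exists>x<N. \<exists>K. finite K \<and> card K = r \<and> (\<forall>q\<in>K. focused k f x q))"
proof (induction r)
  case 0
  show ?case by (rule exI[of _ 1]) (auto intro!: exI[of _ "{}"])
next
  case (Suc r)
  then obtain N where N: "\<And>f. f \<in> {..<N} \<rightarrow> {..<c} \<Longrightarrow> mono_prog_upto k N f \<or>
           (\<exists>x<N. \<exists>K. finite K \<and> card K = r \<and> (\<forall>q\<in>K. focused k f x q))"
    by meson
  define C where "C = {xs. set xs \<subseteq> {..<c} \<and> length xs = N}"
  have "finite C" unfolding C_def by (simp add: finite_lists_length_eq)
  then obtain M where M: "\<And>f. f \<in> {..<M} \<rightarrow> C \<Longrightarrow> has_mono_prog k M f"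
    using has_mono_prog_finite_colors[OF IH] by metis
  have "mono_prog_upto k (M * N) f \<or>
      (\<exists>x<M * N. \<exists>K. finite K \<and> card K = Suc r \<and> (\<forall>q\<in>K. focused k f x q))"
    if f: "f \<in> {..<M * N} \<rightarrow> {..<c}" for f
  proof -
    have inrange: "b * N + y < M * N" if "b < M" "y < N" for b y
    proof -
      have "b * N + y < Suc b * N" using that by simp
      also have "\<dots> \<le> M * N" using that by (intro mult_right_mono) auto
      finally show ?thesis .
    qed
    define blk where "blk b = map (\<lambda>y. f (b * N + y)) [0..<N]" for b
    have "blk \<in> {..<M} \<rightarrow> C"
      using f inrange by (auto simp: blk_def C_def Pi_iff)
    from M[OF this] obtain b e where be: "0 < e" "b + k * e < M"
      and blk: "\<And>i. i < k \<Longrightarrow> blk (b + i * e) = blk b"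
      by (auto simp: has_mono_prog_def)
    have same: "f ((b + i * e) * N + y) = f (b * N + y)" if "i < k" "y < N" for i y
      using blk[OF that(1)] that(2) by (simp add: blk_def)
    have bM: "b < M" using be by linarith
    define g where "g y = f (b * N + y)" for y
    have "g \<in> {..<N} \<rightarrow> {..<c}" using f inrange bM by (auto simp: g_def)
    from N[OF this] consider "mono_prog_upto k N g" |
      x K where "x < N" "finite K" "card K = r" "\<forall>q\<in>K. focused k g x q" by blast
    then show ?thesis
    proof cases
      case 1
      moreover have "b * N + N \<le> M * N"
        using bM by (metis Suc_leI add.commute mult_Suc mult_le_mono1)
      ultimately have "mono_prog_upto k (M * N) f"
        using mono_prog_upto_shift unfolding g_def by blast
      then show ?thesis ..
    next
      case 2
      show ?thesis
      \<comment> \<open>A focus coloured from \<open>K\<close> completes a progression inside the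
        block; otherwise its colour is new.\<close>
      proof (cases "g x \<in> K")
        case True
        then have "mono_prog_upto k N g"
          using 2 mono_prog_upto_focused \<open>0 < k\<close> by blast
        moreover have "b * N + N \<le> M * N"
          using bM by (metis Suc_leI add.commute mult_Suc mult_le_mono1)
        ultimately have "mono_prog_upto k (M * N) f"
          using mono_prog_upto_shift unfolding g_def by blast
        then show ?thesis ..
      next
        case False
        \<comment> \<open>The new focus is the copy of \<open>x\<close> in block
          \<open>b + k * e\<close>. The pattern of this block is not controlled, but the extra term
          of \<open>has_mono_prog\<close> keeps it in range.\<close>
        define X where "X = (b + k * e) * N + x"
        have X: "X < M * N" unfolding X_def using inrange be 2 by blast
        have "focused k f X q" if q: "q \<in> K" for q
        proof -
          obtain a d where ad: "0 < d" "a + k * d = x" "\<forall>i<k. g (a + i * d) = q"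
            using 2 q by (auto simp: focused_def)
          \<comment> \<open>A step of \<open>d + e * N\<close> moves \<open>e\<close> blocks ahead
            and \<open>d\<close> places within the block, so the term of index \<open>i\<close> has
            colour \<open>g (a + i * d)\<close>.\<close>
          have "f ((b * N + a) + i * (d + e * N)) = q" if "i < k" for i
          proof -
            have "i * d \<le> k * d" using that by simp
            then have "a + i * d < N" using ad 2 by linarith
            then have "f ((b + i * e) * N + (a + i * d)) = q"
              using same[OF that] ad(3) that by (simp add: g_def)
            then show ?thesis by (simp add: algebra_simps)
          qed
          moreover have "(b * N + a) + k * (d + e * N) = X"
            using ad(2) unfolding X_def by (auto simp: algebra_simps)
          moreover have "0 < d + e * N" using ad by simp
          ultimately show ?thesis unfolding focused_def by blast
        qed
        moreover have "focused k f X (g x)"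
        proof -
          \<comment> \<open>The copies of \<open>x\<close> in the \<open>k\<close> equal blocks form
            the progression of the new colour.\<close>
          have "f ((b * N + x) + i * (e * N)) = g x" if "i < k" for i
            using same[OF that \<open>x < N\<close>] by (simp add: g_def algebra_simps)
          moreover have "(b * N + x) + k * (e * N) = X"
            unfolding X_def by (simp add: algebra_simps)
          moreover have "0 < e * N" using be 2 by simp
          ultimately show ?thesis unfolding focused_def by blast
        qed
        ultimately have "\<forall>q\<in>insert (g x) K. focused k f X q" by blast
        moreover have "finite (insert (g x) K)" "card (insert (g x) K) = Suc r"
          using 2 False by auto
        ultimately show ?thesis using X by blast
      qed
    qed
  qed
  then show ?case by blast
qed

text \<open>Induction on \<open>k\<close>: \<open>c + 1\<close> colours cannot be focused when only
  \<open>c\<close> occur, so \<open>color_focusing\<close> must yield a progression of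
  \<open>k + 1\<close> terms.\<close>

theorem van_der_Waerden:
  assumes "0 < k"
  shows "\<exists>N. \<forall>f \<in> {..<N} \<rightarrow> {..<c::nat}. has_mono_prog k N f"
  using assms
proof (induction k arbitrary: c rule: nat_induct_non_zero)
  case 1
  show ?case
    unfolding has_mono_prog_def by (intro exI[of _ 2] ballI exI[of _ 0] exI[of _ 1]) auto
next
  case (Suc k)
  obtain N where N: "\<And>f. f \<in> {..<N} \<rightarrow> {..<c} \<Longrightarrow> mono_prog_upto k N f \<or>
           (\<exists>x<N. \<exists>K. finite K \<and> card K = Suc c \<and> (\<forall>q\<in>K. focused k f x q))"
    using color_focusing[OF Suc.IH Suc.hyps] by meson
  have "has_mono_prog (Suc k) (2 * N) f" if f: "f \<in> {..<2 * N} \<rightarrow> {..<c}" for f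
  proof -
    have fN: "f \<in> {..<N} \<rightarrow> {..<c}" using f by auto
    have "K \<subseteq> {..<c}" if x: "x < N" and K: "\<forall>q\<in>K. focused k f x q" for x K
    proof
      fix q assume "q \<in> K"
      then obtain a d where "a + k * d = x" "\<forall>i<k. f (a + i * d) = q"
        using K unfolding focused_def by blast
      then have "f a = q" "a < N" using Suc.hyps x by (auto dest!: spec[of _ 0])
      then show "q \<in> {..<c}" using fN by auto
    qed
    then have "\<not> (\<exists>x<N. \<exists>K. finite K \<and> card K = Suc c \<and> (\<forall>q\<in>K. focused k f x q))"
      by (metis card_lessThan card_mono finite_lessThan not_less_eq_eq order_refl)
    with N[OF fN] obtain a d where ad: "0 < d" "a + k * d < N" "\<forall>i\<le>k. f (a + i * d) = f a"
      by (auto simp: mono_prog_upto_def)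
    \<comment> \<open>Doubling \<open>N\<close> makes room for the extra term that follows the
      \<open>k + 1\<close> terms found.\<close>
    have "d \<le> k * d" using Suc.hyps by simp
    then have "a + Suc k * d < 2 * N" using ad(2) unfolding mult_Suc by linarith
    then show ?thesis using ad by (auto simp: has_mono_prog_def less_Suc_eq_le)
  qed
  then show ?case by blast
qed

text \<open>Some length works, so the \<open>LEAST\<close> is attained. The shift by
  \<open>Suc\<close> passes from positions counted from 0 to positions counted from 1 and makes the
  first term positive.\<close>

lemma vdW_prop_vdW:
  assumes "0 < k"
  shows "0 < vdW k c \<and> vdW_prop k c (vdW k c)"
proof -
  obtain N where N: "\<And>f. f \<in> {..<N} \<rightarrow> {..<c} \<Longrightarrow> has_mono_prog k N f"
    using van_der_Waerden[OF assms] by metis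
  have prog: "\<exists>P\<in>arith_progs k. P \<subseteq> {1..Suc N} \<and> f constant_on P"
    if f: "f \<in> {1..Suc N} \<rightarrow> {..<c}" for f
  proof -
    have "(\<lambda>y. f (Suc y)) \<in> {..<N} \<rightarrow> {..<c}" using f by auto
    from N[OF this] obtain a d where ad: "0 < d" "a + k * d < N"
      "\<And>i. i < k \<Longrightarrow> f (Suc (a + i * d)) = f (Suc a)"
      by (auto simp: has_mono_prog_def)
    define P where "P = (\<lambda>i. Suc a + i * d) ` {..<k}"
    have "P \<in> arith_progs k" using ad(1) unfolding P_def arith_progs_def by blast
    moreover have "P \<subseteq> {1..Suc N}"
    proof -
      have "i * d \<le> k * d" if "i < k" for i using that by simp
      then have "a + i * d \<le> N" if "i < k" for i
        using ad(2) that by (meson add_left_mono le_trans less_imp_le)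
      then show ?thesis unfolding P_def by auto
    qed
    moreover have "f constant_on P" using ad(3) unfolding P_def constant_on_def by auto
    ultimately show ?thesis by blast
  qed
  then have "0 < Suc N \<and> vdW_prop k c (Suc N)" unfolding vdW_prop_def by blast
  then show ?thesis unfolding vdW_def by (rule LeastI)
qed

section \<open>Counting colourings without monochromatic edges\<close>

text \<open>Extensional functions make the colourings of a finite \<open>S\<close> a finite set.
  Edges not inside \<open>S\<close> impose nothing, so one \<open>E\<close> serves all subsets in
  the induction.\<close>

definition proper_colorings :: "nat \<Rightarrow> 'a set set \<Rightarrow> 'a set \<Rightarrow> ('a \<Rightarrow> nat) set" where
  "proper_colorings c E S =
     {f \<in> S \<rightarrow>\<^sub>E {..<c}. \<forall>e\<in>E. e \<subseteq> S \<longrightarrow> \<not> f constant_on e}"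

lemma finite_proper_colorings: "finite S \<Longrightarrow> finite (proper_colorings c E S)"
  unfolding proper_colorings_def by (rule finite_subset[OF _ finite_PiE[of S "\<lambda>_. {..<c}"]]) auto

lemma constant_on_cong:
  assumes "\<And>x. x \<in> e \<Longrightarrow> f x = g x"
  shows "f constant_on e \<longleftrightarrow> g constant_on e"
  using assms unfolding constant_on_def by auto

lemma restrict_proper_coloring:
  assumes "f \<in> proper_colorings c E S" and "T \<subseteq> S"
  shows "restrict f T \<in> proper_colorings c E T"
proof -
  have "restrict f T constant_on e \<longleftrightarrow> f constant_on e" if "e \<subseteq> T" for e
    using that by (intro constant_on_cong) auto
  then show ?thesis
    using assms unfolding proper_colorings_def
    by (auto simp: PiE_iff)
qed

text \<open>Among the extensions of proper colourings to \<open>v\<close>, the bad ones are charged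
  to edges through \<open>v\<close>. Each such edge is handled by deleting \<open>k - 2\<close>
  points at once, hence the form of \<open>grow\<close> for arbitrary \<open>T\<close>.\<close>

lemma proper_colorings_extend:
  assumes fin: "finite S" and "v \<notin> S" and "2 \<le> k"
    and edges: "\<And>e. e \<in> E \<Longrightarrow> finite e \<and> card e = k"
    and deg: "real (card {e \<in> E. e \<subseteq> insert v S \<and> v \<in> e}) \<le> \<Delta>"
    and "0 < \<beta>" and \<beta>: "\<beta> + \<Delta> / \<beta> ^ (k - 2) \<le> real c"
    and grow: "\<And>T. T \<subseteq> S \<Longrightarrow>
      \<beta> ^ card (S - T) * real (card (proper_colorings c E T)) \<le> real (card (proper_colorings c E S))"
  shows "\<beta> * real (card (proper_colorings c E S)) \<le> real (card (proper_colorings c E (insert v S)))"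
proof -
  let ?N = "\<lambda>S. card (proper_colorings c E S)"
  define A where "A = {f \<in> insert v S \<rightarrow>\<^sub>E {..<c}. restrict f S \<in> proper_colorings c E S}"
  define D where "D = {e \<in> E. e \<subseteq> insert v S \<and> v \<in> e}"
  define B where "B e = {f \<in> A. f constant_on e}" for e
  have finA: "finite A" unfolding A_def
    by (rule finite_subset[OF _ finite_PiE[of "insert v S" "\<lambda>_. {..<c}"]]) (use fin in auto)
  have finD: "finite D" unfolding D_def
    by (rule finite_subset[of _ "Pow (insert v S)"]) (use fin in auto)
  \<comment> \<open>Each proper colouring of \<open>S\<close> has \<open>c\<close> distinct
    extensions in \<open>A\<close>, one for each colour of \<open>v\<close>.\<close>
  have cA: "c * ?N S \<le> card A"
  proof -
    have restr: "restrict (g(v := y)) S = g" if "g \<in> proper_colorings c E S" for g y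
      using that \<open>v \<notin> S\<close> unfolding proper_colorings_def by (auto simp: PiE_iff extensional_def)
    have "inj_on (\<lambda>(y, g). g(v := y)) ({..<c} \<times> proper_colorings c E S)"
    proof (rule inj_onI, clarify)
      fix y g y' g'
      assume g: "g \<in> proper_colorings c E S" "g' \<in> proper_colorings c E S"
        and eq: "g(v := y) = g'(v := y')"
      have "g = g'" using restr[OF g(1), of y] restr[OF g(2), of y'] eq by simp
      moreover have "y = y'" using fun_cong[OF eq, of v] by simp
      ultimately show "y = y' \<and> g = g'" by simp
    qed
    moreover have "(\<lambda>(y, g). g(v := y)) ` ({..<c} \<times> proper_colorings c E S) \<subseteq> A"
      using restr unfolding A_def by (auto simp: proper_colorings_def PiE_iff extensional_def)
    ultimately have "card ({..<c} \<times> proper_colorings c E S) \<le> card A"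
      using finA by (intro card_inj_on_le)
    then show ?thesis by (simp add: card_cartesian_product)
  qed
  have cover: "A \<subseteq> proper_colorings c E (insert v S) \<union> (\<Union>e\<in>D. B e)"
  proof
    fix f assume f: "f \<in> A"
    show "f \<in> proper_colorings c E (insert v S) \<union> (\<Union>e\<in>D. B e)"
    proof (cases "f \<in> proper_colorings c E (insert v S)")
      case False
      then obtain e where e: "e \<in> E" "e \<subseteq> insert v S" "f constant_on e"
        using f unfolding A_def proper_colorings_def by blast
      have "v \<in> e"
      proof (rule ccontr)
        assume "v \<notin> e"
        then have "e \<subseteq> S" using e by auto
        moreover from this have "restrict f S constant_on e"
          using e(3) by (subst constant_on_cong[of _ _ f]) auto
        ultimately show False
          using f e(1) unfolding A_def proper_colorings_def by blast
      qed
      then show ?thesis using e f unfolding D_def B_def by blast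
    qed auto
  qed
  have cB: "real (card (B e)) \<le> real (?N S) / \<beta> ^ (k - 2)" if e: "e \<in> D" for e
  proof -
    have e': "e \<in> E" "e \<subseteq> insert v S" "v \<in> e" using e by (auto simp: D_def)
    then have "finite e" "card e = k" using edges by auto
    then have "card (e - {v}) = k - 1" using e' by simp
    then have "e - {v} \<noteq> {}" using \<open>2 \<le> k\<close> by fastforce
    then obtain u where u: "u \<in> e" "u \<noteq> v" by blast
    \<comment> \<open>Of \<open>e\<close> only \<open>u\<close> is kept: its colour fixes that of
      all of \<open>e\<close>, including \<open>v\<close>. This deletes from \<open>S\<close> the
      \<open>k - 2\<close> points of \<open>e\<close> other than \<open>u\<close> and
      \<open>v\<close>.\<close>
    define T where "T = S - (e - {u})"
    have "S - T = e - {u, v}" using e' u \<open>v \<notin> S\<close> unfolding T_def by auto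
    moreover have "card (e - {u, v}) = k - 2"
      using \<open>finite e\<close> \<open>card e = k\<close> u e' by (simp add: card_Diff_subset)
    ultimately have "card (S - T) = k - 2" by simp
    moreover have "T \<subseteq> S" unfolding T_def by auto
    ultimately have NT: "\<beta> ^ (k - 2) * real (?N T) \<le> real (?N S)" using grow by metis
    have "inj_on (\<lambda>f. restrict f T) (B e)"
    proof (rule inj_onI)
      fix f g assume fg: "f \<in> B e" "g \<in> B e" and eq: "restrict f T = restrict g T"
      have T: "f y = g y" if "y \<in> T" for y using fun_cong[OF eq, of y] that by simp
      have "u \<in> T" using u e' unfolding T_def by auto
      show "f = g"
      proof
        fix y
        consider "y \<in> T" | "y \<in> e" | "y \<notin> insert v S" using e' unfolding T_def by blast
        then show "f y = g y"
        proof cases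
          case 2
          then have "f y = f u" "g y = g u"
            using fg u unfolding B_def constant_on_def by auto
          then show ?thesis using T[OF \<open>u \<in> T\<close>] by simp
        next
          case 3
          have "f \<in> extensional (insert v S)" "g \<in> extensional (insert v S)"
            using fg unfolding B_def A_def by (auto simp: PiE_iff)
          then show ?thesis using 3 by (metis extensional_arb)
        qed (use T in auto)
      qed
    qed
    moreover have "(\<lambda>f. restrict f T) ` B e \<subseteq> proper_colorings c E T"
    proof clarify
      fix f assume "f \<in> B e"
      then have "restrict f S \<in> proper_colorings c E S" by (simp add: B_def A_def)
      from restrict_proper_coloring[OF this \<open>T \<subseteq> S\<close>]
      show "restrict f T \<in> proper_colorings c E T"
        using \<open>T \<subseteq> S\<close> by (simp add: Int_absorb1)
    qed
    moreover have "finite (proper_colorings c E T)"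
      using fin finite_subset[OF \<open>T \<subseteq> S\<close>] by (intro finite_proper_colorings) auto
    ultimately have "card (B e) \<le> ?N T" by (intro card_inj_on_le)
    then have "\<beta> ^ (k - 2) * real (card (B e)) \<le> \<beta> ^ (k - 2) * real (?N T)"
      using \<open>0 < \<beta>\<close> by simp
    also note NT
    finally show ?thesis using \<open>0 < \<beta>\<close> by (simp add: pos_le_divide_eq mult.commute)
  qed
  have finB: "finite (B e)" for e using finA by (simp add: B_def)
  have "card A \<le> card (proper_colorings c E (insert v S) \<union> (\<Union>e\<in>D. B e))"
    using cover fin finD finB by (intro card_mono) (auto intro: finite_proper_colorings)
  also have "\<dots> \<le> ?N (insert v S) + card (\<Union>e\<in>D. B e)" by (rule card_Un_le)
  also have "\<dots> \<le> ?N (insert v S) + (\<Sum>e\<in>D. card (B e))"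
    using card_UN_le[OF finD] by simp
  finally have "c * ?N S \<le> ?N (insert v S) + (\<Sum>e\<in>D. card (B e))" using cA by linarith
  then have "real (c * ?N S) \<le> real (?N (insert v S) + (\<Sum>e\<in>D. card (B e)))"
    by (simp only: of_nat_le_iff)
  then have main: "real c * ?N S \<le> ?N (insert v S) + (\<Sum>e\<in>D. real (card (B e)))"
    by simp
  have "(\<Sum>e\<in>D. real (card (B e))) \<le> real (card D) * (real (?N S) / \<beta> ^ (k - 2))"
    using cB by (rule sum_bounded_above)
  also have "\<dots> \<le> \<Delta> * (real (?N S) / \<beta> ^ (k - 2))"
    using deg \<open>0 < \<beta>\<close> unfolding D_def by (intro mult_right_mono) auto
  finally have "real c * ?N S - \<Delta> / \<beta> ^ (k - 2) * ?N S \<le> ?N (insert v S)"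
    using main by simp
  moreover have "(\<beta> + \<Delta> / \<beta> ^ (k - 2)) * ?N S \<le> real c * ?N S"
    using \<beta> by (intro mult_right_mono) auto
  ultimately show ?thesis by (simp add: algebra_simps)
qed

text \<open>Strong induction on \<open>card S\<close>, splitting off one point of
  \<open>S - T\<close>. The hypothesis for all subsets of the smaller set \<open>R\<close> is
  exactly what \<open>proper_colorings_extend\<close> assumes.\<close>

lemma proper_colorings_grow:
  assumes fin: "finite V" and "2 \<le> k"
    and edges: "\<And>e. e \<in> E \<Longrightarrow> finite e \<and> card e = k"
    and deg: "\<And>v. v \<in> V \<Longrightarrow> real (card {e \<in> E. e \<subseteq> V \<and> v \<in> e}) \<le> \<Delta>"
    and "0 < \<beta>" and \<beta>: "\<beta> + \<Delta> / \<beta> ^ (k - 2) \<le> real c"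
    and "T \<subseteq> S" "S \<subseteq> V"
  shows "\<beta> ^ card (S - T) * real (card (proper_colorings c E T)) \<le> real (card (proper_colorings c E S))"
proof -
  have "finite S" using fin \<open>S \<subseteq> V\<close> finite_subset by blast
  then show ?thesis using \<open>T \<subseteq> S\<close> \<open>S \<subseteq> V\<close>
  proof (induction "card S" arbitrary: S T rule: less_induct)
    case less
    show ?case
    proof (cases "T = S")
      case False
      then obtain v where v: "v \<in> S" "v \<notin> T" using less.prems by blast
      define R where "R = S - {v}"
      have S: "S = insert v R" and vR: "v \<notin> R" using v by (auto simp: R_def)
      have "finite R" "T \<subseteq> R" "R \<subseteq> V"
        using less.prems v by (auto simp: R_def)
      have "card R < card S"
        using S vR \<open>finite R\<close> by simp
      have IH: "\<beta> ^ card (R - Q) * real (card (proper_colorings c E Q))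
          \<le> real (card (proper_colorings c E R))" if "Q \<subseteq> R" for Q
        using less.hyps[OF \<open>card R < card S\<close> \<open>finite R\<close> that \<open>R \<subseteq> V\<close>] .
      have "card {e \<in> E. e \<subseteq> insert v R \<and> v \<in> e} \<le> card {e \<in> E. e \<subseteq> V \<and> v \<in> e}"
        using less.prems S
        by (intro card_mono rev_finite_subset[OF finite_Pow_iff[THEN iffD2, OF fin]]) auto
      then have "real (card {e \<in> E. e \<subseteq> insert v R \<and> v \<in> e}) \<le> \<Delta>"
        using deg[of v] v less.prems by fastforce
      from proper_colorings_extend[OF \<open>finite R\<close> vR \<open>2 \<le> k\<close> edges this \<open>0 < \<beta>\<close> \<beta> IH]
      have step: "\<beta> * real (card (proper_colorings c E R)) \<le> real (card (proper_colorings c E S))"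
        unfolding S .
      have "S - T = insert v (R - T)" using S v by auto
      then have "card (S - T) = Suc (card (R - T))" using \<open>finite R\<close> vR by simp
      then have "\<beta> ^ card (S - T) * real (card (proper_colorings c E T))
          = \<beta> * (\<beta> ^ card (R - T) * real (card (proper_colorings c E T)))" by simp
      also have "\<dots> \<le> \<beta> * real (card (proper_colorings c E R))"
        using IH[OF \<open>T \<subseteq> R\<close>] \<open>0 < \<beta>\<close> by simp
      finally show ?thesis using step by linarith
    qed simp
  qed
qed

text \<open>Growth from the empty set, which has exactly one proper colouring, leaves at least
  \<open>\<beta> ^ card V\<close> colourings on \<open>V\<close>.\<close>

theorem exists_proper_coloring:
  assumes "finite V" and "2 \<le> k"
    and "\<And>e. e \<in> E \<Longrightarrow> finite e \<and> card e = k"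
    and "\<And>v. v \<in> V \<Longrightarrow> real (card {e \<in> E. e \<subseteq> V \<and> v \<in> e}) \<le> \<Delta>"
    and "0 < \<beta>" and "\<beta> + \<Delta> / \<beta> ^ (k - 2) \<le> real c"
  shows "\<exists>f. f \<in> proper_colorings c E V"
proof -
  \<comment> \<open>Every function is constant on the empty set, so an empty edge would rule out
    even the empty colouring.\<close>
  have "{} \<notin> E" using assms(2,3) by fastforce
  then have "proper_colorings c E {} = {\<lambda>_. undefined}"
    by (auto simp: proper_colorings_def)
  then have "\<beta> ^ card V \<le> real (card (proper_colorings c E V))"
    using proper_colorings_grow[OF assms, of "{}" V] by simp
  moreover have "0 < \<beta> ^ card V" using \<open>0 < \<beta>\<close> by simp
  ultimately have "0 < card (proper_colorings c E V)" by linarith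
  then show ?thesis by (metis card_gt_0_iff ex_in_conv)
qed

section \<open>The lower bound\<close>

lemma card_arith_prog:
  assumes "P \<in> arith_progs k"
  shows "finite P \<and> card P = k"
proof -
  obtain a d where P: "P = (\<lambda>i. a + i * d) ` {..<k}" and "0 < d"
    using assms by (auto simp: arith_progs_def)
  have "inj_on (\<lambda>i. a + i * d) {..<k}" using \<open>0 < d\<close> by (auto simp: inj_on_def)
  then show ?thesis by (simp add: P card_image)
qed

text \<open>A progression through \<open>v\<close> is determined by the index of \<open>v\<close> in
  it and by its gap, and \<open>k - 1\<close> gaps must fit between 1 and \<open>n\<close>.\<close>

lemma card_arith_progs_containing:
  assumes "2 \<le> k"
  shows "card {P \<in> arith_progs k. P \<subseteq> {1..n} \<and> v \<in> P} \<le> k * ((n - 1) div (k - 1))"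
proof -
  let ?m = "(n - 1) div (k - 1)"
  let ?F = "\<lambda>(i, d). (\<lambda>j. v - i * d + j * d) ` {..<k}"
  have "{P \<in> arith_progs k. P \<subseteq> {1..n} \<and> v \<in> P} \<subseteq> ?F ` ({..<k} \<times> {1..?m})"
  proof clarify
    fix P assume P: "P \<in> arith_progs k" "P \<subseteq> {1..n}" "v \<in> P"
    then obtain a d where Pad: "P = (\<lambda>i. a + i * d) ` {..<k}" and "0 < a" "0 < d"
      by (auto simp: arith_progs_def)
    then obtain i where i: "i < k" "v = a + i * d" using P by auto
    have "a + (k - 1) * d \<in> P" using Pad assms by auto
    then have "a + (k - 1) * d \<le> n" using P by auto
    then have "d * (k - 1) \<le> n - 1" using \<open>0 < a\<close> by (simp add: mult.commute)
    then have "d \<le> ?m" using assms by (simp add: less_eq_div_iff_mult_less_eq)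
    moreover have "P = ?F (i, d)" using Pad i by simp
    ultimately show "P \<in> ?F ` ({..<k} \<times> {1..?m})" using i \<open>0 < d\<close> by (intro rev_image_eqI[of "(i, d)"]) auto
  qed
  then have "card {P \<in> arith_progs k. P \<subseteq> {1..n} \<and> v \<in> P} \<le> card (?F ` ({..<k} \<times> {1..?m}))"
    by (intro card_mono) auto
  also have "\<dots> \<le> card ({..<k} \<times> {1..?m})" by (intro card_image_le) auto
  finally show ?thesis by simp
qed

lemma not_vdW_prop:
  assumes k: "2 \<le> k" and c: "2 \<le> c"
    and n: "real n < real c powr (real k - 3) / real k * ((real k - 1) / real k)"
  shows "\<not> vdW_prop k c n"
proof -
  define \<Delta> where "\<Delta> = real c powr (real k - 3) / real k"
  \<comment> \<open>This choice gives away \<open>c / (2 * k)\<close>, which has to cover the error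
    term \<open>\<Delta> / \<beta> ^ (k - 2)\<close>.\<close>
  define \<beta> where "\<beta> = real c * (1 - 1 / (2 * real k))"
  have deg: "real (card {P \<in> arith_progs k. P \<subseteq> {1..n} \<and> v \<in> P}) \<le> \<Delta>" for v
  proof -
    have "real (card {P \<in> arith_progs k. P \<subseteq> {1..n} \<and> v \<in> P})
        \<le> real (k * ((n - 1) div (k - 1)))"
      using card_arith_progs_containing[OF k] by (simp only: of_nat_le_iff)
    also have "\<dots> \<le> real k * (real (n - 1) / real (k - 1))"
      unfolding of_nat_mult by (intro mult_left_mono of_nat_div_le_of_nat) auto
    also have "\<dots> \<le> real k * (real n / (real k - 1))"
      using k by (intro mult_left_mono frac_le) auto
    \<comment> \<open>The factor \<open>(k - 1) / k\<close> of the bound on \<open>n\<close> is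
      chosen to cancel the \<open>k / (k - 1)\<close> of the degree estimate.\<close>
    also have "\<dots> \<le> real k * ((\<Delta> * ((real k - 1) / real k)) / (real k - 1))"
      using n k unfolding \<Delta>_def by (intro mult_left_mono divide_right_mono) auto
    also have "\<dots> = \<Delta>" using k by (simp add: field_simps)
    finally show ?thesis .
  qed
  have "0 < \<beta>" using k c by (simp add: \<beta>_def)
  have "\<Delta> / \<beta> ^ (k - 2) \<le> real c / (2 * real k)"
  proof -
    \<comment> \<open>By Bernoulli, replacing \<open>c\<close> by \<open>\<beta>\<close> costs at
      most a factor 2 in the power \<open>k - 2\<close>.\<close>
    have "1 + real (k - 2) * (- (1 / (2 * real k))) \<le> (1 + - (1 / (2 * real k))) ^ (k - 2)"
      using k by (intro Bernoulli_inequality) (simp add: field_simps)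
    moreover have "1 / 2 \<le> 1 + real (k - 2) * (- (1 / (2 * real k)))"
      using k by (simp add: field_simps)
    ultimately have "1 / 2 \<le> (1 - 1 / (2 * real k)) ^ (k - 2)" by simp
    then have "real c ^ (k - 2) * (1 / 2) \<le> \<beta> ^ (k - 2)"
      unfolding \<beta>_def power_mult_distrib by (intro mult_left_mono) auto
    moreover have "real c powr (real k - 3) = real c ^ (k - 2) / real c"
    proof -
      \<comment> \<open>The exponent is -1 when \<open>k = 2\<close>, so one factor \<open>c\<close>
        is split off to leave a natural power.\<close>
      have "real k - 3 = real (k - 2) - 1" using k by simp
      moreover have "real c powr (real (k - 2) - 1) = real c ^ (k - 2) / real c"
        using c by (simp only: powr_diff powr_one powr_realpow of_nat_0_less_iff)
      ultimately show ?thesis by (simp only:)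
    qed
    moreover have "0 < real c ^ (k - 2)" using c by simp
    ultimately have "\<Delta> / \<beta> ^ (k - 2) \<le> (real c ^ (k - 2) / real c / real k) / (real c ^ (k - 2) * (1 / 2))"
      unfolding \<Delta>_def using \<open>0 < \<beta>\<close> by (simp only:) (intro divide_left_mono, auto)
    also have "\<dots> = 2 / (real c * real k)" using c by (simp add: field_simps)
    also have "\<dots> \<le> real c / (2 * real k)"
    proof -
      \<comment> \<open>The comparison amounts to \<open>4 \<le> c * c\<close>, which is where at
        least two colours enter.\<close>
      have "2 * 2 \<le> real c * real c" using c by (intro mult_mono) auto
      then show ?thesis using c k by (simp add: field_simps)
    qed
    finally show ?thesis .
  qed
  moreover have "\<beta> + real c / (2 * real k) = real c" by (simp add: \<beta>_def algebra_simps)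
  ultimately have "\<beta> + \<Delta> / \<beta> ^ (k - 2) \<le> real c" by linarith
  from exists_proper_coloring[OF finite_atLeastAtMost k card_arith_prog deg \<open>0 < \<beta>\<close> this]
  obtain f where "f \<in> proper_colorings c (arith_progs k) {1..n}" by blast
  then have "f \<in> {1..n} \<rightarrow> {..<c}"
    "\<forall>P\<in>arith_progs k. P \<subseteq> {1..n} \<longrightarrow> \<not> f constant_on P"
    by (auto simp: proper_colorings_def PiE_iff)
  then show ?thesis unfolding vdW_prop_def by blast
qed

text \<open>If the bound failed, \<open>not_vdW_prop\<close> at \<open>n = vdW k c\<close> would
  contradict \<open>vdW_prop_vdW\<close>. In the remaining cases the bound is 0 for
  \<open>k = 1\<close> and at most 1 for \<open>c = 1\<close>.\<close>

lemma vdW_lower_bound: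
  assumes "0 < k" and "0 < c"
  shows "real c powr (real k - 3) / real k * ((real k - 1) / real k) \<le> real (vdW k c)"
proof (cases "2 \<le> k \<and> 2 \<le> c")
  case True
  then show ?thesis
    using not_vdW_prop[of k c "vdW k c"] vdW_prop_vdW[OF \<open>0 < k\<close>, of c] by fastforce
next
  case False
  then consider "k = 1" | "c = 1" using assms by linarith
  then show ?thesis
  proof cases
    case 2
    have "1 / real k * ((real k - 1) / real k) \<le> 1 * 1"
      using assms by (intro mult_mono) auto
    also have "\<dots> \<le> real (vdW k c)" using vdW_prop_vdW[OF \<open>0 < k\<close>, of c] by simp
    finally show ?thesis using 2 by simp
  qed simp
qed

theorem theorem1:
  shows "(\<forall>k c :: nat. 0 < k \<longrightarrow> 0 < c \<longrightarrow>
            real (vdW k c) \<ge> real c powr (real k - 3) / real k * ((real k - 1) / real k)) \<and>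
         (\<exists>\<epsilon> :: nat \<Rightarrow> real. \<epsilon> \<longlonglongrightarrow> 0 \<and>
            (\<forall>k c :: nat. 0 < k \<longrightarrow> 0 < c \<longrightarrow>
               real c powr (real k - 3) / real k * ((real k - 1) / real k) =
               real c powr (real k - 3) / real k * (1 - \<epsilon> k)))"
\<comment> \<open>The error is \<open>1 / k\<close>, since \<open>(k - 1) / k = 1 - 1 / k\<close>
  for positive \<open>k\<close>.\<close>
proof (intro conjI exI[of _ "\<lambda>k. 1 / real k"] allI impI)
  show "(\<lambda>k. 1 / real k) \<longlonglongrightarrow> 0" by (rule lim_1_over_n)
qed (simp_all only: vdW_lower_bound, simp add: diff_divide_distrib)

end
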